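(* Let $m_1,m_2\ge 1$ and let $G_1\in\mathcal{G}_{m_1}$, $G_2\in\mathcal{G}_{m_2}$ be two marked groups. Suppose that $G_1$ and $G_2$ are isomorphic as abstract groups. Then there are clopen (closed and open) neighbourhoods $V_i$ of $G_i$ in $\mathcal{G}_{m_i}$, $i=1,2$, and a homeomorphism $\varphi:V_1\to V_2$ mapping $G_1$ to $G_2$ and preserving isomorphism classes, i.e. such that for every $H\in V_1$, the group $\varphi(H)$ is isomorphic to $H$ as an abstract group.
   Context: For a group $G$, $\mathcal{G}(G)$ denotes the set of normal subgroups of $G$, with the topology induced by the product topology on $\{0,1\}^G$ (the power set of $G$). A normal subgroup $N$ is identified with the quotient $G/N$. For $m\ge 1$, $F_m$ is the free group of rank $m$ with a fixed free generating family, and $\mathcal{G}_m=\mathcal{G}(F_m)$ is the space of marked groups on $m$ generators; a point $N\in\mathcal{G}_m$ is viewed as the group $F_m/N$ together with the images of the $m$ free generators. The "abstract group" of a point $N$ is $F_m/N$, forgetting the marking. *)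

theory Defs
  imports "HOL-Algebra.Coset" "HOL-Analysis.Function_Topology"
begin

text \<open>A letter \<open>(i, True)\<close> stands for the \<open>i\<close>-th free generator and \<open>(i, False)\<close> for its inverse.
  The free group of rank \<open>m\<close> is realised on the reduced words in the letters with \<open>i < m\<close>.\<close>

type_synonym letter = "nat \<times> bool"

definition inv_letter :: "letter \<Rightarrow> letter" where
  "inv_letter x = (fst x, \<not> snd x)"

definition reduced :: "letter list \<Rightarrow> bool" where
  "reduced w \<longleftrightarrow> successively (\<lambda>x y. y \<noteq> inv_letter x) w"

fun push :: "letter \<Rightarrow> letter list \<Rightarrow> letter list" where
  "push x [] = [x]"
| "push x (y # w) = (if y = inv_letter x then w else x # y # w)"

text \<open>\<open>foldr push u v\<close> is the reduced form of the concatenation of \<open>u\<close> and \<open>v\<close> when \<open>v\<close> is reduced.\<close>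

definition free_group :: "nat \<Rightarrow> letter list monoid" where
  "free_group m =
     \<lparr>carrier = {w. reduced w \<and> set w \<subseteq> {..<m} \<times> UNIV}, mult = foldr push, one = []\<rparr>"

definition free_gen :: "nat \<Rightarrow> letter list" where
  "free_gen i = [(i, True)]"

lemma inv_letter_simps [simp]:
  "inv_letter (inv_letter x) = x" "inv_letter x \<noteq> x" "x \<noteq> inv_letter x"
  "fst (inv_letter x) = fst x"
  by (auto simp: inv_letter_def prod_eq_iff)

lemma reduced_simps [simp]:
  "reduced []" "reduced [x]"
  "reduced (x # y # w) \<longleftrightarrow> y \<noteq> inv_letter x \<and> reduced (y # w)"
  by (auto simp: reduced_def)

lemma reduced_ConsD: "reduced (x # w) \<Longrightarrow> reduced w"
  by (cases w) auto

lemma reduced_push: "reduced w \<Longrightarrow> reduced (push x w)"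
  by (cases w) (auto dest: reduced_ConsD)

lemma push_eq_Cons: "reduced (x # w) \<Longrightarrow> push x w = x # w"
  by (cases w) auto

lemma push_inv: "reduced w \<Longrightarrow> push (inv_letter x) (push x w) = w"
proof (cases w)
  case (Cons y v)
  assume "reduced w"
  then show ?thesis using Cons by (cases v) auto
qed simp

lemma push_inv': "reduced w \<Longrightarrow> push x (push (inv_letter x) w) = w"
  using push_inv [of w "inv_letter x"] by simp

lemma reduced_foldr_push: "reduced v \<Longrightarrow> reduced (foldr push u v)"
  by (induction u) (auto intro: reduced_push)

lemma foldr_push_push:
  "reduced w \<Longrightarrow> foldr push (push x u) w = push x (foldr push u w)"
  using push_inv' [of "foldr push _ w" x] reduced_foldr_push [of w]
  by (cases u) (auto simp: inv_letter_def)

lemma foldr_push_assoc: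
  "reduced w \<Longrightarrow> foldr push (foldr push u v) w = foldr push u (foldr push v w)"
  by (induction u) (auto simp: foldr_push_push)

lemma foldr_push_Nil: "reduced u \<Longrightarrow> foldr push u [] = u"
proof (induction u)
  case (Cons x u)
  then show ?case using reduced_ConsD [of x u] push_eq_Cons [of x u] by simp
qed simp

lemma set_push: "set (push x w) \<subseteq> insert x (set w)"
  by (cases w) auto

lemma set_foldr_push: "set (foldr push u v) \<subseteq> set u \<union> set v"
proof (induction u)
  case (Cons x u)
  then show ?case using set_push [of x "foldr push u v"] by auto
qed simp

lemma foldr_push_inverse:
  "reduced w \<Longrightarrow> foldr push (rev (map inv_letter u)) (foldr push u w) = w"
  by (induction u arbitrary: w) (auto simp: push_inv reduced_foldr_push)

lemma carrier_free_group_iff: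
  "w \<in> carrier (free_group m) \<longleftrightarrow> reduced w \<and> set w \<subseteq> {..<m} \<times> UNIV"
  by (simp add: free_group_def)

lemma mult_free_group [simp]: "u \<otimes>\<^bsub>free_group m\<^esub> v = foldr push u v"
  by (simp add: free_group_def)

lemma one_free_group [simp]: "\<one>\<^bsub>free_group m\<^esub> = []"
  by (simp add: free_group_def)

lemma group_free_group: "group (free_group m)"
proof (rule groupI)
  fix u v assume "u \<in> carrier (free_group m)" "v \<in> carrier (free_group m)"
  then show "u \<otimes>\<^bsub>free_group m\<^esub> v \<in> carrier (free_group m)"
    using reduced_foldr_push [of v u] set_foldr_push [of u v]
    by (auto simp: carrier_free_group_iff)
next
  fix u assume u: "u \<in> carrier (free_group m)"
  define v where "v = foldr push (rev (map inv_letter u)) []"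
  have "set (rev (map inv_letter u)) \<subseteq> {..<m} \<times> UNIV"
    using u by (auto simp: carrier_free_group_iff inv_letter_def)
  then have "v \<in> carrier (free_group m)"
    using set_foldr_push [of "rev (map inv_letter u)" "[]"] reduced_foldr_push [of "[]"]
    unfolding v_def carrier_free_group_iff by force
  moreover have "foldr push v u = []"
  proof -
    have "foldr push v u = foldr push (rev (map inv_letter u)) u"
      using u foldr_push_assoc [of u _ "[]"] by (simp add: v_def carrier_free_group_iff)
    also have "\<dots> = foldr push (rev (map inv_letter u)) (foldr push u [])"
      using u by (simp add: foldr_push_Nil carrier_free_group_iff)
    finally show ?thesis by (simp only: foldr_push_inverse reduced_simps)
  qed
  ultimately show "\<exists>v\<in>carrier (free_group m). v \<otimes>\<^bsub>free_group m\<^esub> u = \<one>\<^bsub>free_group m\<^esub>"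
    by auto
qed (auto simp: carrier_free_group_iff foldr_push_assoc)

text \<open>The universal property of the family \<open>free_gen\<close>.\<close>

lemma free_gen_carrier: "i < m \<Longrightarrow> free_gen i \<in> carrier (free_group m)"
  by (simp add: free_gen_def carrier_free_group_iff)

lemma free_group_hom_exists:
  assumes "group G" and f: "f \<in> {..<m} \<rightarrow> carrier G"
  shows "\<exists>h \<in> hom (free_group m) G. \<forall>i<m. h (free_gen i) = f i"
proof -
  interpret group G by fact
  define L where "L x = (if snd x then f (fst x) else inv\<^bsub>G\<^esub> f (fst x))" for x
  define h where "h w = foldr (\<lambda>x y. L x \<otimes>\<^bsub>G\<^esub> y) w \<one>\<^bsub>G\<^esub>" for w
  have L: "L x \<in> carrier G" if "fst x < m" for x
    using f that by (auto simp: L_def)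
  have L_inv: "L (inv_letter x) = inv\<^bsub>G\<^esub> L x" if "fst x < m" for x
  proof -
    have "f (fst x) \<in> carrier G" using f that by auto
    then show ?thesis by (auto simp: L_def inv_letter_def)
  qed
  have h: "h w \<in> carrier G" if "set w \<subseteq> {..<m} \<times> UNIV" for w
    using that by (induction w) (auto simp: h_def L)
  have h_push: "h (push x w) = L x \<otimes>\<^bsub>G\<^esub> h w" if "fst x < m" "set w \<subseteq> {..<m} \<times> UNIV" for x w
  proof (cases w)
    case (Cons y v)
    have hv: "h v \<in> carrier G" using that Cons h by auto
    show ?thesis
    proof (cases "y = inv_letter x")
      case True
      have "L x \<otimes>\<^bsub>G\<^esub> (L y \<otimes>\<^bsub>G\<^esub> h v) = h v"
        using L [OF that(1)] hv True L_inv [OF that(1)] by (simp add: m_assoc [symmetric])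
      then show ?thesis using True Cons by (simp add: h_def)
    qed (simp add: Cons h_def)
  qed (simp add: h_def)
  have h_mult: "h (foldr push u v) = h u \<otimes>\<^bsub>G\<^esub> h v"
    if "set u \<subseteq> {..<m} \<times> UNIV" "set v \<subseteq> {..<m} \<times> UNIV" for u v
    using that(1)
  proof (induction u)
    case Nil
    then show ?case using h that(2) by (simp add: h_def)
  next
    case (Cons x u)
    then have x: "fst x < m" and u: "set u \<subseteq> {..<m} \<times> UNIV" by auto
    have "set (foldr push u v) \<subseteq> {..<m} \<times> UNIV" using set_foldr_push [of u v] u that(2) by auto
    then have "h (foldr push (x # u) v) = L x \<otimes>\<^bsub>G\<^esub> (h u \<otimes>\<^bsub>G\<^esub> h v)"
      using h_push x Cons.IH u by simp
    also have "\<dots> = h (x # u) \<otimes>\<^bsub>G\<^esub> h v"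
      using L [OF x] h [OF u] h [OF that(2)] m_assoc [of "L x" "h u" "h v"] by (simp add: h_def)
    finally show ?case .
  qed
  have "h \<in> hom (free_group m) G"
    using h h_mult by (auto simp: hom_def carrier_free_group_iff)
  moreover have "h (free_gen i) = f i" if "i < m" for i
  proof -
    have "f i \<in> carrier G" using f that by auto
    then show ?thesis by (simp add: h_def free_gen_def L_def)
  qed
  ultimately show ?thesis by blast
qed

lemma free_group_hom_unique:
  assumes "group G" and h: "h \<in> hom (free_group m) G" and k: "k \<in> hom (free_group m) G"
    and eq: "\<And>i. i < m \<Longrightarrow> h (free_gen i) = k (free_gen i)"
    and w: "w \<in> carrier (free_group m)"
  shows "h w = k w"
proof -
  interpret F: group "free_group m" by (rule group_free_group)
  interpret h: group_hom "free_group m" G h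
    using assms F.is_group by (simp add: group_hom_def group_hom_axioms_def)
  interpret k: group_hom "free_group m" G k
    using assms F.is_group by (simp add: group_hom_def group_hom_axioms_def)
  have letter: "h [x] = k [x]" if x: "fst x < m" for x
  proof (cases "snd x")
    case True
    then show ?thesis using eq [OF x] by (metis free_gen_def prod.collapse)
  next
    case False
    have g: "free_gen (fst x) \<in> carrier (free_group m)" using x by (rule free_gen_carrier)
    have "[x] = inv\<^bsub>free_group m\<^esub> free_gen (fst x)"
      by (rule F.inv_equality [symmetric])
        (use False x g in \<open>auto simp: free_gen_def carrier_free_group_iff inv_letter_def prod_eq_iff mem_Times_iff\<close>)
    then show ?thesis using eq [OF x] g by simp
  qed
  from w show ?thesis
  proof (induction w)
    case Nil
    then show ?case using h.hom_one k.hom_one by simp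
  next
    case (Cons x w)
    then have w: "w \<in> carrier (free_group m)" and x: "[x] \<in> carrier (free_group m)" "fst x < m"
      by (auto simp: carrier_free_group_iff dest: reduced_ConsD)
    have "x # w = [x] \<otimes>\<^bsub>free_group m\<^esub> w"
      using Cons.prems by (simp add: carrier_free_group_iff push_eq_Cons)
    then show ?case
      using h.hom_mult [OF x(1) w] k.hom_mult [OF x(1) w] letter [OF x(2)] Cons.IH [OF w] by metis
  qed
qed

text \<open>The topology induced from the product topology on \<open>{0,1}\<^sup>G\<close>: a normal subgroup is sent to
  its indicator function on \<open>carrier G\<close>.\<close>

definition normal_subgroup_space :: "('a, 'b) monoid_scheme \<Rightarrow> 'a set topology" where
  "normal_subgroup_space G =
     pullback_topology {N. N \<lhd> G} (\<lambda>N. \<lambda>g\<in>carrier G. g \<in> N)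
       (product_topology (\<lambda>_. discrete_topology (UNIV :: bool set)) (carrier G))"

lemma topspace_normal_subgroup_space [simp]: "topspace (normal_subgroup_space G) = {N. N \<lhd> G}"
  by (auto simp: normal_subgroup_space_def topspace_pullback_topology)

definition marked_groups :: "nat \<Rightarrow> letter list set topology" where
  "marked_groups m = normal_subgroup_space (free_group m)"

end

theory Submission
  imports Defs
begin

text \<open>
  Write \<open>F\<close> and \<open>K\<close> for the free groups of ranks \<open>m1\<close> and \<open>m2\<close>. Since they are free, the given
  isomorphism \<open>F / N1 \<cong> K / N2\<close> and its inverse lift to homomorphisms \<open>a : F \<rightarrow> K\<close> and
  \<open>b : K \<rightarrow> F\<close>. The lifts need not be mutually inverse, but \<open>b \<circ> a\<close> is the identity modulo \<open>N1\<close>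
  and \<open>a \<circ> b\<close> is the identity modulo \<open>N2\<close>.

  A homomorphism out of a free group is determined on the generators, so ``\<open>b \<circ> a\<close> is the identity
  modulo \<open>H\<close>'' amounts to finitely many elements lying in \<open>H\<close>. It therefore defines a clopen set
  \<open>V1\<close> of normal subgroups \<open>H\<close> of \<open>F\<close>, and \<open>V2\<close> is defined likewise from \<open>a \<circ> b\<close>. For \<open>H \<in> V1\<close>
  put \<open>\<phi> H = b\<^sup>-\<^sup>1(H)\<close>. The map \<open>K \<rightarrow> F / H\<close> induced by \<open>b\<close> has kernel \<open>\<phi> H\<close>, and it is onto
  because every \<open>x\<close> is congruent to \<open>b (a x)\<close> modulo \<open>H\<close>; so \<open>K / \<phi> H \<cong> F / H\<close>. Taking preimages
  under \<open>a\<close> undoes \<open>\<phi>\<close>, because \<open>a\<^sup>-\<^sup>1(b\<^sup>-\<^sup>1(H)) = (b \<circ> a)\<^sup>-\<^sup>1(H) = H\<close>, and taking preimages is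
  continuous because \<open>y \<in> b\<^sup>-\<^sup>1(H)\<close> is the condition \<open>b y \<in> H\<close> on a single coordinate of \<open>H\<close>.
\<close>

section \<open>The topology on normal subgroups\<close>

lemma continuous_map_normal_subgroup_mem:
  assumes "g \<in> carrier G"
  shows "continuous_map (normal_subgroup_space G) (discrete_topology UNIV) (\<lambda>N. g \<in> N)"
proof -
  have "continuous_map (normal_subgroup_space G) (discrete_topology UNIV)
      ((\<lambda>\<chi>. \<chi> g) \<circ> (\<lambda>N. \<lambda>g\<in>carrier G. g \<in> N))"
    unfolding normal_subgroup_space_def
    by (intro continuous_map_pullback continuous_map_product_projection assms)
  then show ?thesis
    using assms by (simp add: comp_def)
qed

lemma clopen_normal_subgroup_mem:
  assumes "g \<in> carrier G"
  shows "openin (normal_subgroup_space G) {N. N \<lhd> G \<and> g \<in> N}"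
    and "closedin (normal_subgroup_space G) {N. N \<lhd> G \<and> g \<in> N}"
  using openin_continuous_map_preimage [OF continuous_map_normal_subgroup_mem [OF assms], of "{True}"]
    closedin_continuous_map_preimage [OF continuous_map_normal_subgroup_mem [OF assms], of "{True}"]
  by simp_all

lemma clopen_normal_subgroup_superset:
  assumes "finite S" and "S \<subseteq> carrier G"
  shows "openin (normal_subgroup_space G) {N. N \<lhd> G \<and> S \<subseteq> N}
    \<and> closedin (normal_subgroup_space G) {N. N \<lhd> G \<and> S \<subseteq> N}"
  using assms
proof (induction S)
  case empty
  then show ?case
    using openin_topspace [of "normal_subgroup_space G"]
      closedin_topspace [of "normal_subgroup_space G"] by simp
next
  case (insert g S)
  have "{N. N \<lhd> G \<and> insert g S \<subseteq> N} = {N. N \<lhd> G \<and> g \<in> N} \<inter> {N. N \<lhd> G \<and> S \<subseteq> N}"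
    by auto
  then show ?case
    using insert clopen_normal_subgroup_mem [of g G] by (simp add: openin_Int closedin_Int)
qed

lemma continuous_map_into_normal_subgroup_space:
  assumes "\<And>x. x \<in> topspace X \<Longrightarrow> f x \<lhd> G"
    and "\<And>g. g \<in> carrier G \<Longrightarrow> continuous_map X (discrete_topology UNIV) (\<lambda>x. g \<in> f x)"
  shows "continuous_map X (normal_subgroup_space G) f"
  unfolding normal_subgroup_space_def
proof (rule continuous_map_pullback')
  show "continuous_map X (product_topology (\<lambda>_. discrete_topology UNIV) (carrier G))
      ((\<lambda>N. \<lambda>g\<in>carrier G. g \<in> N) \<circ> f)"
    by (rule continuous_map_coordinatewise_then_product) (simp_all add: assms(2))
qed (use assms(1) in auto)

section \<open>Preimages of normal subgroups\<close>

definition hom_preimage :: "('b, 'd) monoid_scheme \<Rightarrow> ('b \<Rightarrow> 'a) \<Rightarrow> 'a set \<Rightarrow> 'b set" where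
  "hom_preimage K b H = {y \<in> carrier K. b y \<in> H}"

lemma rcos_eq_iff:
  assumes "group G" and "subgroup H G" and "x \<in> carrier G" and "y \<in> carrier G"
  shows "H #>\<^bsub>G\<^esub> x = H #>\<^bsub>G\<^esub> y \<longleftrightarrow> x \<otimes>\<^bsub>G\<^esub> inv\<^bsub>G\<^esub> y \<in> H"
  using assms group.rcos_self [OF assms(1)] group.repr_independence [OF assms(1)]
    subgroup.rcos_module [OF assms(2,1,4,3)]
  by metis

lemma rcos_eq_self_iff:
  assumes "group G" and "subgroup H G" and "x \<in> carrier G"
  shows "H #>\<^bsub>G\<^esub> x = H \<longleftrightarrow> x \<in> H"
  using assms group.coset_join1 group.coset_join2 by metis

lemma group_hom_comp_rcos:
  assumes "group G" and "group K" and "b \<in> hom K G" and "H \<lhd> G"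
  shows "group_hom K (G Mod H) (\<lambda>y. H #>\<^bsub>G\<^esub> b y)"
  using assms hom_compose [OF assms(3) normal.r_coset_hom_Mod [OF assms(4)]]
    normal.factorgroup_is_group [OF assms(4)]
  by (simp add: group_hom_def group_hom_axioms_def comp_def)

lemma hom_preimage_eq_kernel:
  assumes "group G" and "b \<in> hom K G" and "H \<lhd> G"
  shows "hom_preimage K b H = kernel K (G Mod H) (\<lambda>y. H #>\<^bsub>G\<^esub> b y)"
  using rcos_eq_self_iff [OF assms(1) normal_imp_subgroup [OF assms(3)] hom_in_carrier [OF assms(2)]]
  by (auto simp: hom_preimage_def kernel_def)

lemma normal_hom_preimage:
  assumes "group G" and "group K" and "b \<in> hom K G" and "H \<lhd> G"
  shows "hom_preimage K b H \<lhd> K"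
  using group_hom.normal_kernel [OF group_hom_comp_rcos [OF assms]] assms
  by (simp add: hom_preimage_eq_kernel)

lemma continuous_map_hom_preimage:
  assumes "group G" and "group K" and "b \<in> hom K G"
  shows "continuous_map (normal_subgroup_space G) (normal_subgroup_space K) (hom_preimage K b)"
proof (rule continuous_map_into_normal_subgroup_space)
  fix g assume g: "g \<in> carrier K"
  then have "continuous_map (normal_subgroup_space G) (discrete_topology UNIV) (\<lambda>H. b g \<in> H)"
    by (intro continuous_map_normal_subgroup_mem hom_in_carrier [OF assms(3)])
  then show "continuous_map (normal_subgroup_space G) (discrete_topology UNIV)
      (\<lambda>H. g \<in> hom_preimage K b H)"
    using g by (simp add: hom_preimage_def)
qed (use assms normal_hom_preimage in auto)

text \<open>A section of \<open>b\<close> modulo \<open>H\<close> makes the induced map \<open>K \<rightarrow> G / H\<close> surjective, and the first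
  isomorphism theorem applies to it.\<close>

lemma Mod_hom_preimage_iso:
  assumes "group G" and "group K" and b: "b \<in> hom K G" and "H \<lhd> G"
    and a: "a \<in> carrier G \<rightarrow> carrier K"
    and a_section: "\<And>x. x \<in> carrier G \<Longrightarrow> H #>\<^bsub>G\<^esub> b (a x) = H #>\<^bsub>G\<^esub> x"
  shows "K Mod hom_preimage K b H \<cong> G Mod H"
proof -
  have "(\<lambda>y. H #>\<^bsub>G\<^esub> b y) ` carrier K = carrier (G Mod H)"
  proof
    show "carrier (G Mod H) \<subseteq> (\<lambda>y. H #>\<^bsub>G\<^esub> b y) ` carrier K"
      using a_section a by (force simp: carrier_FactGroup)
  qed (use b in \<open>auto simp: carrier_FactGroup hom_in_carrier\<close>)
  then show ?thesis
    using group_hom.FactGroup_iso [OF group_hom_comp_rcos [OF assms(1-4)]] assms(1-4)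
    by (simp add: hom_preimage_eq_kernel)
qed

section \<open>Normal subgroups modulo which an endomorphism of a free group is trivial\<close>

text \<open>The condition is imposed on the generators alone, so that it concerns only finitely many
  elements.\<close>

definition fixing_subgroups :: "nat \<Rightarrow> (letter list \<Rightarrow> letter list) \<Rightarrow> letter list set set" where
  "fixing_subgroups m e = {H. H \<lhd> free_group m \<and>
     (\<lambda>i. e (free_gen i) \<otimes>\<^bsub>free_group m\<^esub> inv\<^bsub>free_group m\<^esub> free_gen i) ` {..<m} \<subseteq> H}"

lemma clopen_fixing_subgroups:
  assumes "e \<in> hom (free_group m) (free_group m)"
  shows "openin (marked_groups m) (fixing_subgroups m e)"
    and "closedin (marked_groups m) (fixing_subgroups m e)"
proof -
  interpret F: group "free_group m" by (rule group_free_group)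
  have "(\<lambda>i. e (free_gen i) \<otimes>\<^bsub>free_group m\<^esub> inv\<^bsub>free_group m\<^esub> free_gen i) ` {..<m}
      \<subseteq> carrier (free_group m)"
    using hom_in_carrier [OF assms] free_gen_carrier F.m_closed F.inv_closed by blast
  then show "openin (marked_groups m) (fixing_subgroups m e)"
    and "closedin (marked_groups m) (fixing_subgroups m e)"
    unfolding fixing_subgroups_def marked_groups_def
    using clopen_normal_subgroup_superset by blast+
qed

text \<open>Two homomorphisms to the quotient by \<open>H\<close>, the one induced by \<open>e\<close> and the projection, agree as
  soon as they agree on the generators.\<close>

lemma fixing_subgroups_iff:
  assumes e: "e \<in> hom (free_group m) (free_group m)"
  shows "H \<in> fixing_subgroups m e \<longleftrightarrow> H \<lhd> free_group m \<and>
    (\<forall>x\<in>carrier (free_group m). H #>\<^bsub>free_group m\<^esub> e x = H #>\<^bsub>free_group m\<^esub> x)"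
proof (cases "H \<lhd> free_group m")
  case True
  let ?F = "free_group m"
  note F = group_free_group [of m]
  have gens: "H \<in> fixing_subgroups m e \<longleftrightarrow>
      (\<forall>i<m. H #>\<^bsub>?F\<^esub> e (free_gen i) = H #>\<^bsub>?F\<^esub> free_gen i)"
    using True rcos_eq_iff [OF F normal_imp_subgroup [OF True]] hom_in_carrier [OF e]
      free_gen_carrier
    by (auto simp: fixing_subgroups_def simp del: mult_free_group)
  have "H #>\<^bsub>?F\<^esub> e x = H #>\<^bsub>?F\<^esub> x"
    if "\<forall>i<m. H #>\<^bsub>?F\<^esub> e (free_gen i) = H #>\<^bsub>?F\<^esub> free_gen i" and "x \<in> carrier ?F" for x
    using free_group_hom_unique [OF normal.factorgroup_is_group [OF True],
        of "\<lambda>x. H #>\<^bsub>?F\<^esub> e x" m "\<lambda>x. H #>\<^bsub>?F\<^esub> x" x]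
      group_hom.homh [OF group_hom_comp_rcos [OF F F e True]]
      normal.r_coset_hom_Mod [OF True] that
    by blast
  then show ?thesis
    using True gens free_gen_carrier by blast
qed (simp add: fixing_subgroups_def)

section \<open>The homeomorphism given by a pair of homomorphisms\<close>

text \<open>With \<open>x = b y\<close>, the congruence of \<open>b (a x)\<close> and \<open>x\<close> modulo \<open>H\<close> says that \<open>b\<close> maps \<open>a (b y)\<close>
  and \<open>y\<close> to the same class, that is, that \<open>a (b y)\<close> and \<open>y\<close> are congruent modulo \<open>b\<^sup>-\<^sup>1(H)\<close>.\<close>

lemma hom_preimage_fixing_subgroups:
  assumes a: "a \<in> hom (free_group m1) (free_group m2)"
    and b: "b \<in> hom (free_group m2) (free_group m1)"
    and H: "H \<in> fixing_subgroups m1 (b \<circ> a)"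
  shows "hom_preimage (free_group m2) b H \<in> fixing_subgroups m2 (a \<circ> b)"
    and "hom_preimage (free_group m1) a (hom_preimage (free_group m2) b H) = H"
proof -
  let ?F = "free_group m1" and ?K = "free_group m2"
  let ?M = "hom_preimage ?K b H"
  note F = group_free_group [of m1] and K = group_free_group [of m2]
  interpret b: group_hom ?K ?F b
    using b F K by (simp add: group_hom_def group_hom_axioms_def)
  have HF: "H \<lhd> ?F"
    and eq: "\<And>x. x \<in> carrier ?F \<Longrightarrow> H #>\<^bsub>?F\<^esub> b (a x) = H #>\<^bsub>?F\<^esub> x"
    using H by (simp_all add: fixing_subgroups_iff [OF hom_compose [OF a b]])
  have HS: "subgroup H ?F" using HF by (rule normal_imp_subgroup)
  have M: "?M \<lhd> ?K" by (rule normal_hom_preimage [OF F K b HF])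
  have "?M #>\<^bsub>?K\<^esub> a (b y) = ?M #>\<^bsub>?K\<^esub> y" if y: "y \<in> carrier ?K" for y
  proof -
    have ab: "a (b y) \<in> carrier ?K" using y a by (simp add: hom_in_carrier)
    have "b (a (b y)) \<otimes>\<^bsub>?F\<^esub> inv\<^bsub>?F\<^esub> b y \<in> H"
      using eq [of "b y"] rcos_eq_iff [OF F HS, of "b (a (b y))" "b y"] y ab
      by (simp del: mult_free_group)
    then have "a (b y) \<otimes>\<^bsub>?K\<^esub> inv\<^bsub>?K\<^esub> y \<in> ?M"
      using y ab by (simp add: hom_preimage_def del: mult_free_group)
    then show ?thesis
      using rcos_eq_iff [OF K normal_imp_subgroup [OF M] ab y] by blast
  qed
  then show "?M \<in> fixing_subgroups m2 (a \<circ> b)"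
    using M by (simp add: fixing_subgroups_iff [OF hom_compose [OF b a]])
  have "b (a x) \<in> H \<longleftrightarrow> x \<in> H" if x: "x \<in> carrier ?F" for x
    using eq [OF x] rcos_eq_self_iff [OF F HS] x hom_in_carrier [OF a] b.hom_closed by metis
  then show "hom_preimage ?F a ?M = H"
    using subgroup.subset [OF HS] hom_in_carrier [OF a] by (auto simp: hom_preimage_def)
qed

lemma homeomorphic_map_hom_preimage:
  assumes a: "a \<in> hom (free_group m1) (free_group m2)"
    and b: "b \<in> hom (free_group m2) (free_group m1)"
  shows "homeomorphic_map (subtopology (marked_groups m1) (fixing_subgroups m1 (b \<circ> a)))
    (subtopology (marked_groups m2) (fixing_subgroups m2 (a \<circ> b)))
    (hom_preimage (free_group m2) b)"
proof -
  have "homeomorphic_maps (subtopology (marked_groups m1) (fixing_subgroups m1 (b \<circ> a)))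
    (subtopology (marked_groups m2) (fixing_subgroups m2 (a \<circ> b)))
    (hom_preimage (free_group m2) b) (hom_preimage (free_group m1) a)"
    unfolding homeomorphic_maps_def marked_groups_def continuous_map_in_subtopology
    using hom_preimage_fixing_subgroups [OF a b] hom_preimage_fixing_subgroups [OF b a]
      continuous_map_hom_preimage [OF group_free_group group_free_group b]
      continuous_map_hom_preimage [OF group_free_group group_free_group a]
    by (simp add: continuous_map_from_subtopology)
  then show ?thesis
    using homeomorphic_maps_map by blast
qed

section \<open>Lifting homomorphisms between quotients\<close>

text \<open>The lift is chosen on the free generators and extended to a homomorphism.\<close>

lemma free_group_hom_lift:
  assumes "group G" and N: "N \<lhd> free_group m" and M: "M \<lhd> G"
    and h: "h \<in> hom (free_group m Mod N) (G Mod M)"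
  obtains a where "a \<in> hom (free_group m) G"
    and "\<And>x. x \<in> carrier (free_group m) \<Longrightarrow> M #>\<^bsub>G\<^esub> a x = h (N #>\<^bsub>free_group m\<^esub> x)"
proof -
  let ?F = "free_group m"
  have hN: "(\<lambda>x. h (N #>\<^bsub>?F\<^esub> x)) \<in> hom ?F (G Mod M)"
    using hom_compose [OF normal.r_coset_hom_Mod [OF N] h] by (simp add: comp_def)
  have "\<exists>y\<in>carrier G. M #>\<^bsub>G\<^esub> y = h (N #>\<^bsub>?F\<^esub> free_gen i)" if "i < m" for i
    using hom_in_carrier [OF hN free_gen_carrier [OF that]] by (auto simp: carrier_FactGroup)
  then obtain f where f: "\<And>i. i < m \<Longrightarrow> f i \<in> carrier G"
      "\<And>i. i < m \<Longrightarrow> M #>\<^bsub>G\<^esub> f i = h (N #>\<^bsub>?F\<^esub> free_gen i)"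
    by metis
  obtain a where a: "a \<in> hom ?F G" "\<And>i. i < m \<Longrightarrow> a (free_gen i) = f i"
    using free_group_hom_exists [OF assms(1), of f m] f(1) by auto
  have "M #>\<^bsub>G\<^esub> a x = h (N #>\<^bsub>?F\<^esub> x)" if "x \<in> carrier ?F" for x
    by (rule free_group_hom_unique [OF normal.factorgroup_is_group [OF M] _ hN _ that])
      (use group_hom.homh [OF group_hom_comp_rcos [OF assms(1) group_free_group a(1) M]] a f in auto)
  with a(1) show thesis by (rule that)
qed

theorem lemma1:
  fixes m1 m2 :: nat and N1 N2 :: "letter list set"
  assumes "m1 \<ge> 1" and "m2 \<ge> 1"
    and "N1 \<in> topspace (marked_groups m1)" and "N2 \<in> topspace (marked_groups m2)"
    and "free_group m1 Mod N1 \<cong> free_group m2 Mod N2"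
  shows "\<exists>V1 V2 \<phi>.
      openin (marked_groups m1) V1 \<and> closedin (marked_groups m1) V1 \<and> N1 \<in> V1 \<and>
      openin (marked_groups m2) V2 \<and> closedin (marked_groups m2) V2 \<and> N2 \<in> V2 \<and>
      homeomorphic_map (subtopology (marked_groups m1) V1) (subtopology (marked_groups m2) V2) \<phi> \<and>
      \<phi> N1 = N2 \<and>
      (\<forall>H\<in>V1. free_group m2 Mod (\<phi> H) \<cong> free_group m1 Mod H)"
proof -
  let ?F = "free_group m1" and ?K = "free_group m2"
  note F = group_free_group [of m1] and K = group_free_group [of m2]
  have N1: "N1 \<lhd> ?F" and N2: "N2 \<lhd> ?K"
    using assms(3,4) by (simp_all add: marked_groups_def)
  note FN = normal.factorgroup_is_group [OF N1] and KN = normal.factorgroup_is_group [OF N2]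
  obtain \<theta> where \<theta>: "\<theta> \<in> iso (?F Mod N1) (?K Mod N2)"
    using assms(5) by (auto simp: is_iso_def)
  define \<eta> where "\<eta> = inv_into (carrier (?F Mod N1)) \<theta>"
  have \<eta>: "\<eta> \<in> iso (?K Mod N2) (?F Mod N1)"
    unfolding \<eta>_def by (rule group.iso_set_sym [OF FN \<theta>])
  have bij: "bij_betw \<theta> (carrier (?F Mod N1)) (carrier (?K Mod N2))"
    using \<theta> by (simp add: iso_def)
  have \<eta>\<theta>: "\<eta> (\<theta> X) = X" if "X \<in> carrier (?F Mod N1)" for X
    using bij_betw_inv_into_left [OF bij that] by (simp add: \<eta>_def)
  obtain a where a: "a \<in> hom ?F ?K"
    and a_lift: "\<And>x. x \<in> carrier ?F \<Longrightarrow> N2 #>\<^bsub>?K\<^esub> a x = \<theta> (N1 #>\<^bsub>?F\<^esub> x)"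
    using free_group_hom_lift [OF K N1 N2, of \<theta>] \<theta> by (auto simp: iso_def)
  obtain b where b: "b \<in> hom ?K ?F"
    and b_lift: "\<And>y. y \<in> carrier ?K \<Longrightarrow> N1 #>\<^bsub>?F\<^esub> b y = \<eta> (N2 #>\<^bsub>?K\<^esub> y)"
    using free_group_hom_lift [OF F N2 N1, of \<eta>] \<eta> by (auto simp: iso_def)
  let ?V1 = "fixing_subgroups m1 (b \<circ> a)" and ?V2 = "fixing_subgroups m2 (a \<circ> b)"
  let ?\<phi> = "hom_preimage ?K b"
  have ba: "b \<circ> a \<in> hom ?F ?F" and ab: "a \<circ> b \<in> hom ?K ?K"
    using hom_compose a b by blast+
  have "N1 #>\<^bsub>?F\<^esub> b (a x) = N1 #>\<^bsub>?F\<^esub> x" if x: "x \<in> carrier ?F" for x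
    using b_lift [OF hom_in_carrier [OF a x]] a_lift [OF x] \<eta>\<theta> x by (simp add: carrier_FactGroup)
  then have N1V: "N1 \<in> ?V1"
    using N1 by (simp add: fixing_subgroups_iff [OF ba])
  \<comment> \<open>Modulo \<open>N1\<close>, \<open>b\<close> is the projection of \<open>K\<close> onto \<open>K / N2\<close> followed by the injective \<open>\<eta>\<close>; both
    \<open>b\<^sup>-\<^sup>1(N1)\<close> and \<open>N2\<close> are therefore the kernel of this map.\<close>
  have \<phi>N1: "?\<phi> N1 = N2"
  proof -
    have "b y \<in> N1 \<longleftrightarrow> y \<in> N2" if y: "y \<in> carrier ?K" for y
    proof -
      have by_carrier: "b y \<in> carrier ?F" using b y by (rule hom_in_carrier)
      have "\<eta> N2 = N1"
        using hom_one [of \<eta>, OF _ KN FN] \<eta> by (simp add: iso_def)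
      moreover have "inj_on \<eta> (carrier (?K Mod N2))"
        using \<eta> by (simp add: iso_def bij_betw_def)
      moreover have "N2 \<in> carrier (?K Mod N2)" "N2 #>\<^bsub>?K\<^esub> y \<in> carrier (?K Mod N2)"
        using monoid.one_closed [OF group.is_monoid [OF KN]] y by (auto simp: carrier_FactGroup)
      ultimately have "\<eta> (N2 #>\<^bsub>?K\<^esub> y) = N1 \<longleftrightarrow> N2 #>\<^bsub>?K\<^esub> y = N2"
        by (metis inj_onD)
      then show ?thesis
        using b_lift [OF y] rcos_eq_self_iff [OF F normal_imp_subgroup [OF N1] by_carrier]
          rcos_eq_self_iff [OF K normal_imp_subgroup [OF N2] y] by simp
    qed
    then show ?thesis
      using subgroup.subset [OF normal_imp_subgroup [OF N2]] by (auto simp: hom_preimage_def)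
  qed
  have N2V: "N2 \<in> ?V2"
    using hom_preimage_fixing_subgroups(1) [OF a b N1V] \<phi>N1 by simp
  have iso: "\<forall>H\<in>?V1. ?K Mod ?\<phi> H \<cong> ?F Mod H"
  proof
    fix H assume "H \<in> ?V1"
    then have "H \<lhd> ?F" "\<And>x. x \<in> carrier ?F \<Longrightarrow> H #>\<^bsub>?F\<^esub> b (a x) = H #>\<^bsub>?F\<^esub> x"
      by (simp_all add: fixing_subgroups_iff [OF ba])
    then show "?K Mod ?\<phi> H \<cong> ?F Mod H"
      using Mod_hom_preimage_iso [OF F K b] hom_carrier [OF a] by blast
  qed
  show ?thesis
    by (intro exI [of _ ?V1] exI [of _ ?V2] exI [of _ ?\<phi>])
      (use clopen_fixing_subgroups [OF ba] clopen_fixing_subgroups [OF ab] N1V N2V \<phi>N1 iso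
        homeomorphic_map_hom_preimage [OF a b] in blast)
qed

end
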